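(* For every positive integer $k$, $$\frac{1}{\phi (Q)} \sum_{\substack{\chi \bmod Q \\ \chi \neq \chi_0}} \bigg\lvert L^{(k)} \Big( \frac{1}{2} , \chi \Big) \bigg\rvert^2 = \frac{(\log q)^{2k}}{2k+1} (\deg Q)^{2k+1} + O \Big( ( \log q )^{2k} (\deg Q)^{2k}\Big)$$ as $\deg Q \to \infty$ with $Q \in \mathbb{F}_q[t]$ a monic prime polynomial.
   Context: $q$ is a prime power, $\mathcal{A} = \mathbb{F}_q[t]$, and $\mathcal{M} \subset \mathcal{A}$ is the set of monic polynomials. For $A \in \mathcal{A}\setminus\{0\}$, $\lvert A \rvert := q^{\deg A}$. "Prime" means monic irreducible polynomial. $\phi(Q) = \lvert (\mathcal{A}/Q\mathcal{A})^* \rvert$. A Dirichlet character of modulus $R \in \mathcal{M}$ is a function $\chi$ from $\mathcal{A}$ to the complex numbers such that for all $A,B \in \mathcal{A}$: $\chi(A)=\chi(B)$ if $A \equiv B \pmod R$; $\chi(AB)=\chi(A)\chi(B)$; and $\chi(A)=0$ if and only if $A$ and $R$ are not coprime. The trivial character $\chi_0$ of modulus $R$ satisfies $\chi_0(A)=1$ for all $A$ coprime to $R$. A sum over $\chi \bmod Q$ runs over all Dirichlet characters of modulus $Q$. For $\Re(s)>1$, $L(s,\chi) := \sum_{A \in \mathcal{M}} \chi(A)\lvert A\rvert^{-s}$, extended analytically to $\mathbb{C}$ for $\chi \ne \chi_0$; $L^{(k)}$ is the $k$-th derivative with respect to $s$. $O(X)$ as $\deg Q \to \infty$: a quantity bounded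 in absolute value by $C X$ for all monic primes $Q$ with $\deg Q$ sufficiently large, where $C$ is an absolute constant (not depending on $k$, $q$ or $Q$). *)

theory Defs
  imports "HOL-Complex_Analysis.Complex_Analysis" "HOL-Algebra.Polynomial_Divisibility"
begin

text \<open>
  The finite field \<open>F\<close> is a ring record in the sense of HOL-Algebra, rather than a type of class
  field, so that all finite fields can be quantified over below one and the same constant
  (up to isomorphism they all occur already for \<open>'a = nat\<close>).
  The ring of polynomials over it is the library's \<^term>\<open>poly_ring F\<close>: a polynomial is its list
  of coefficients, leading coefficient first, and the zero polynomial is the empty list.
\<close>

definition monic_polys :: "'a ring \<Rightarrow> 'a list set" where
  "monic_polys F = {A \<in> carrier (poly_ring F). A \<noteq> [] \<and> Polynomials.lead_coeff A = \<one>\<^bsub>F\<^esub>}"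

definition monic_primes :: "'a ring \<Rightarrow> 'a list set" where
  "monic_primes F = {Q \<in> monic_polys F. pirreducible\<^bsub>F\<^esub> (carrier F) Q}"

text \<open>Only meaningful for nonzero \<open>A\<close>.\<close>

definition poly_norm :: "'a ring \<Rightarrow> 'a list \<Rightarrow> nat" where
  "poly_norm F A = card (carrier F) ^ Polynomials.degree A"

definition poly_coprime :: "'a ring \<Rightarrow> 'a list \<Rightarrow> 'a list \<Rightarrow> bool" where
  "poly_coprime F A B \<longleftrightarrow>
     (\<forall>D \<in> carrier (poly_ring F). D pdivides\<^bsub>F\<^esub> A \<and> D pdivides\<^bsub>F\<^esub> B \<longrightarrow> D \<in> Units (poly_ring F))"

definition poly_cong :: "'a ring \<Rightarrow> 'a list \<Rightarrow> 'a list \<Rightarrow> 'a list \<Rightarrow> bool" where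
  "poly_cong F R A B \<longleftrightarrow> R pdivides\<^bsub>F\<^esub> (A \<ominus>\<^bsub>poly_ring F\<^esub> B)"

definition poly_phi :: "'a ring \<Rightarrow> 'a list \<Rightarrow> nat" where
  "poly_phi F Q = card (Units (poly_ring F Quot (PIdl\<^bsub>poly_ring F\<^esub> Q)))"

text \<open>
  Characters are functions on \<^term>\<open>carrier (poly_ring F)\<close>; the condition \<^const>\<open>extensional\<close>
  fixes their values on lists that are not polynomials, so that each character is
  represented by exactly one element of the set and sums over the set count it once.
\<close>

definition dirichlet_characters :: "'a ring \<Rightarrow> 'a list \<Rightarrow> ('a list \<Rightarrow> complex) set" where
  "dirichlet_characters F R =
     {chi \<in> extensional (carrier (poly_ring F)).
        (\<forall>A \<in> carrier (poly_ring F). \<forall>B \<in> carrier (poly_ring F).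
            (poly_cong F R A B \<longrightarrow> chi A = chi B) \<and>
            chi (A \<otimes>\<^bsub>poly_ring F\<^esub> B) = chi A * chi B) \<and>
        (\<forall>A \<in> carrier (poly_ring F). chi A = 0 \<longleftrightarrow> \<not> poly_coprime F A R)}"

definition trivial_character :: "'a ring \<Rightarrow> 'a list \<Rightarrow> ('a list \<Rightarrow> complex)" where
  "trivial_character F R =
     restrict (\<lambda>A. if poly_coprime F A R then 1 else 0) (carrier (poly_ring F))"

definition L_series :: "'a ring \<Rightarrow> ('a list \<Rightarrow> complex) \<Rightarrow> complex \<Rightarrow> complex" where
  "L_series F chi s = (\<Sum>\<^sub>\<infinity>A \<in> monic_polys F. chi A * of_nat (poly_norm F A) powr (- s))"

text \<open>
  The entire function that continues the series; it exists for every nontrivial character,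
  and the lemma below shows that it is unique.
\<close>

definition L_function :: "'a ring \<Rightarrow> ('a list \<Rightarrow> complex) \<Rightarrow> complex \<Rightarrow> complex" where
  "L_function F chi =
     (THE f. f holomorphic_on UNIV \<and> (\<forall>s. Re s > 1 \<longrightarrow> f s = L_series F chi s))"

lemma L_function_eqI:
  assumes f: "f holomorphic_on UNIV" "\<And>s. Re s > 1 \<Longrightarrow> f s = L_series F chi s"
  shows "L_function F chi = f"
  unfolding L_function_def
proof (rule the_equality)
  fix g assume g: "g holomorphic_on UNIV \<and> (\<forall>s. Re s > 1 \<longrightarrow> g s = L_series F chi s)"
  show "g = f"
  proof
    fix z
    show "g z = f z"
    proof (rule analytic_continuation_open[where f = g and g = f and s = "{s. Re s > 1}" and s' = UNIV])
      show "open {s. Re s > 1}" by (rule open_halfspace_Re_gt)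
      show "{s. Re s > 1} \<noteq> {}" by (auto intro!: exI[of _ 2])
    qed (use f g in auto)
  qed
qed (use f in auto)

end

theory Submission
  imports Defs
begin

text \<open>
  Let \<open>q\<close> be the size of the field and \<open>n = degree Q\<close>. The monic polynomials of any fixed degree
  \<open>m \<ge> n\<close> are equidistributed over the residue classes modulo \<open>Q\<close>, so a nontrivial character sums
  to zero over them (\<open>sum_character_monic_degree\<close>). Hence its L-function is the finite sum of
  \<open>chi A * \<bar>A\<bar> powr (- s)\<close> over the monic \<open>A\<close> of degree less than \<open>n\<close> (\<open>L_function_eq\<close>), and
  differentiation of that sum multiplies each term by a power of \<open>- ln \<bar>A\<bar> = - degree A * ln q\<close>.

  What makes the second moment easy is that the polynomials that remain are nonzero and of
  degree less than \<open>n\<close>: they are coprime to \<open>Q\<close>, and two of them are congruent only if they are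
  equal. So when the square is expanded and summed over all characters, including the trivial
  one, orthogonality (\<open>character_orthogonality\<close>) leaves the diagonal alone, and the sum over
  the characters is exactly \<open>phi Q\<close> times
  \<open>\<Sum>A. (degree A * ln q) ^ (2 * k) / \<bar>A\<bar> = (ln q) ^ (2 * k) * (\<Sum>m<n. m ^ (2 * k))\<close>,
  because there are \<open>q ^ m\<close> monic polynomials of degree \<open>m\<close>. The power sum differs from
  \<open>n ^ (2 * k + 1) / (2 * k + 1)\<close> by at most \<open>n ^ (2 * k)\<close>.

  The trivial character was included only to have orthogonality. Its share, divided by
  \<open>(ln q) ^ (2 * k)\<close>, is the square of \<open>\<Sum>m<n. m ^ k * sqrt q ^ m\<close>, a sum dominated by
  its last terms and of order \<open>n ^ k * sqrt q ^ n\<close>; after division by \<open>phi Q = q ^ n - 1\<close> it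
  is again \<open>O(n ^ (2 * k))\<close>, with a constant uniform in \<open>q\<close> since \<open>sqrt q\<close> stays away from
  \<open>1\<close>.

  Orthogonality over the characters requires that there be enough of them. As \<open>Q\<close> is prime,
  the residue ring is a finite field, whose multiplicative group is cyclic, and evaluation at a
  primitive root identifies the characters with the roots of unity of order dividing \<open>phi Q\<close>
  (\<open>bij_betw_characters\<close>).
\<close>

section \<open>Counting polynomials over a finite field\<close>

locale finite_field = field F for F :: "'a ring" (structure) +
  assumes finite_carrier: "finite (carrier F)"
begin

abbreviation q :: nat where "q \<equiv> card (carrier F)"

abbreviation monics :: "nat \<Rightarrow> 'a list set" where
  "monics m \<equiv> {A \<in> monic_polys F. degree A = m}"

lemma q_ge_2: "q \<ge> 2"
proof -
  have "card {\<zero>, \<one>} \<le> q"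
    by (intro card_mono finite_carrier) auto
  then show ?thesis by simp
qed

lemma monic_polys_degree_eq:
  "{A \<in> monic_polys F. degree A = m} = (\<lambda>l. \<one> # l) ` {l. set l \<subseteq> carrier F \<and> length l = m}"
proof (intro equalityI subsetI)
  fix A assume A: "A \<in> {A \<in> monic_polys F. degree A = m}"
  then obtain l where "A = \<one> # l"
    by (cases A) (auto simp: monic_polys_def)
  then show "A \<in> (\<lambda>l. \<one> # l) ` {l. set l \<subseteq> carrier F \<and> length l = m}"
    using A by (auto simp: monic_polys_def univ_poly_carrier[symmetric] polynomial_def)
qed (use one_not_zero in \<open>auto simp: monic_polys_def univ_poly_carrier[symmetric] polynomial_def\<close>)

lemma card_monic_polys_degree:
  shows "finite {A \<in> monic_polys F. degree A = m}"
    and "card {A \<in> monic_polys F. degree A = m} = q ^ m"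
  unfolding monic_polys_degree_eq
  using finite_carrier by (auto simp: card_image card_lists_length_eq finite_lists_length_eq)

lemma card_polys_length_le:
  "finite {A \<in> carrier (poly_ring F). length A \<le> n} \<and>
         card {A \<in> carrier (poly_ring F). length A \<le> n} = q ^ n"
proof (induction n)
  case 0
  have "{A \<in> carrier (poly_ring F). length A \<le> 0} = {[]}"
    by auto
  then show ?case by simp
next
  case (Suc n)
  let ?new = "(\<lambda>(a, l). a # l) ` ((carrier F - {\<zero>}) \<times> {l. set l \<subseteq> carrier F \<and> length l = n})"
  have new: "{A \<in> carrier (poly_ring F). length A = Suc n} = ?new"
  proof (intro equalityI subsetI)
    fix A assume A: "A \<in> {A \<in> carrier (poly_ring F). length A = Suc n}"
    then obtain a l where "A = a # l" by (cases A) auto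
    then show "A \<in> ?new"
      using A by (auto simp: univ_poly_carrier[symmetric] polynomial_def)
  qed (auto simp: univ_poly_carrier[symmetric] polynomial_def)
  have fin: "finite ?new"
    using finite_carrier by (auto simp: finite_lists_length_eq)
  have "card ?new = (q - 1) * q ^ n"
    using finite_carrier by (subst card_image) (auto simp: inj_on_def card_cartesian_product card_lists_length_eq)
  moreover have "{A \<in> carrier (poly_ring F). length A \<le> Suc n} =
      {A \<in> carrier (poly_ring F). length A \<le> n} \<union> {A \<in> carrier (poly_ring F). length A = Suc n}"
    by auto
  moreover have "{A \<in> carrier (poly_ring F). length A \<le> n} \<inter> ?new = {}"
    by auto
  moreover have "q \<ge> 1"
    using finite_carrier by (metis One_nat_def Suc_leI card_gt_0_iff empty_iff zero_closed)
  ultimately show ?case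
    using Suc fin unfolding new by (auto simp: card_Un_disjoint algebra_simps)
qed

text \<open>
  Translation by a polynomial of lower degree maps the monic polynomials of a given degree to
  themselves: the leading coefficient is not touched. Here \<open>length B \<le> degree A\<close> covers the zero
  polynomial as well, whose length is \<open>0\<close>.
\<close>

lemma monic_add_lower_degree:
  assumes "A \<in> monic_polys F" "B \<in> carrier (poly_ring F)" "length B \<le> degree A"
  shows "A \<oplus>\<^bsub>poly_ring F\<^esub> B \<in> monic_polys F" "degree (A \<oplus>\<^bsub>poly_ring F\<^esub> B) = degree A"
proof -
  obtain l where A: "A = \<one> # l" "set l \<subseteq> carrier F"
    using assms(1) by (cases A) (auto simp: monic_polys_def univ_poly_carrier[symmetric] polynomial_def)
  have B: "set B \<subseteq> carrier F"
    using assms(2) by (auto simp: univ_poly_carrier[symmetric] polynomial_def)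
  have len: "length B \<le> length l" using assms(3) A by simp
  have "A \<oplus>\<^bsub>poly_ring F\<^esub> B = \<one> # map2 (\<oplus>) l (replicate (length l - length B) \<zero> @ B)"
    using len one_not_zero by (simp add: A univ_poly_add Suc_diff_le)
  moreover have "x \<oplus> y \<in> carrier F"
    if "(x, y) \<in> set (zip l (replicate (length l - length B) \<zero> @ B))" for x y
    using set_zip_leftD[OF that] set_zip_rightD[OF that] A(2) B by (auto split: if_splits)
  then have "set (map2 (\<oplus>) l (replicate (length l - length B) \<zero> @ B)) \<subseteq> carrier F"
    by auto
  ultimately show "A \<oplus>\<^bsub>poly_ring F\<^esub> B \<in> monic_polys F" "degree (A \<oplus>\<^bsub>poly_ring F\<^esub> B) = degree A"
    using len one_not_zero A by (auto simp: monic_polys_def univ_poly_carrier[symmetric] polynomial_def)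
qed

lemma sum_monic_degree_less:
  "(\<Sum>A | A \<in> monic_polys F \<and> degree A < n. f A) = (\<Sum>m<n. \<Sum>A\<in>monics m. f A)"
proof -
  let ?M = "{A \<in> monic_polys F. degree A < n}"
  have M: "?M = (\<Union>m<n. monics m)"
    by auto
  then have fin: "finite ?M"
    using card_monic_polys_degree(1) by simp
  have "(\<Sum>A\<in>?M. f A) = (\<Sum>m<n. \<Sum>A | A \<in> ?M \<and> degree A = m. f A)"
    by (rule sum.group[symmetric, OF fin]) auto
  also have "\<dots> = (\<Sum>m<n. \<Sum>A\<in>monics m. f A)"
    by (intro sum.cong) auto
  finally show ?thesis .
qed

text \<open>
  Infinite sums over monic polynomials are taken degree by degree through this indexing.
\<close>

lemma bij_betw_monics: "bij_betw snd (Sigma UNIV monics) (monic_polys F)"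
  by (rule bij_betwI[where g = "\<lambda>A. (degree A, A)"]) auto

end

section \<open>Residues modulo a prime polynomial\<close>

locale prime_modulus = finite_field F for F :: "'a ring" (structure) +
  fixes Q :: "'a list"
  assumes Q_prime: "Q \<in> monic_primes F"
begin

abbreviation P :: "'a list ring" where "P \<equiv> poly_ring F"

text \<open>
  The remainders of division by \<open>Q\<close>. The bound is on the length and not on the degree, because the
  degree of the zero polynomial is \<open>0 - 1 = 0\<close>, that of a constant; a polynomial is shorter
  than \<open>Q\<close> if and only if it is zero or of smaller degree.
\<close>

abbreviation residues :: "'a list set" where
  "residues \<equiv> {A \<in> carrier P. length A \<le> degree Q}"

sublocale P: domain P
  by (rule univ_poly_is_domain[OF carrier_is_subring])

lemma Q_carrier: "Q \<in> carrier P" and Q_nonzero: "Q \<noteq> []"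
  and Q_irreducible: "pirreducible (carrier F) Q"
  using Q_prime by (auto simp: monic_primes_def monic_polys_def)

lemma degree_Q_pos: "degree Q \<ge> 1"
  using pirreducible_degree[OF carrier_is_subfield Q_carrier Q_irreducible] .

lemma length_Q: "length Q = Suc (degree Q)"
  using degree_Q_pos by simp

lemma Q_dvd_mult_iff:
  assumes "A \<in> carrier P" "B \<in> carrier P"
  shows "Q pdivides (A \<otimes>\<^bsub>P\<^esub> B) \<longleftrightarrow> Q pdivides A \<or> Q pdivides B"
proof -
  have "pprime (carrier F) Q"
    using pprime_iff_pirreducible[OF carrier_is_subfield Q_carrier] Q_irreducible by simp
  from pprimeE(3)[OF carrier_is_subfield Q_carrier this assms] show ?thesis
    using assms Q_carrier unfolding pdivides_def
    by (metis P.divides_prod_l P.divides_prod_r)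
qed

text \<open>
  Up to units, the only divisors of \<open>Q\<close> are \<open>1\<close> and \<open>Q\<close> itself.
\<close>

lemma poly_coprime_iff:
  assumes "A \<in> carrier P"
  shows "poly_coprime F A Q \<longleftrightarrow> \<not> Q pdivides A"
proof
  assume "poly_coprime F A Q"
  then show "\<not> Q pdivides A"
    using Q_carrier pirreducibleE(2)[OF carrier_is_subring Q_carrier Q_irreducible]
    by (auto simp: poly_coprime_def pdivides_def)
next
  assume nd: "\<not> Q pdivides A"
  show "poly_coprime F A Q"
    unfolding poly_coprime_def
  proof (intro ballI impI)
    fix D assume D: "D \<in> carrier P" "D pdivides A \<and> D pdivides Q"
    then have "D \<in> Units P \<or> D \<sim>\<^bsub>P\<^esub> Q"
      using divides_pirreducible_condition[OF Q_irreducible D(1)] by (simp add: pdivides_def)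
    then show "D \<in> Units P"
      using nd D assms Q_carrier by (auto simp: pdivides_def associated_def intro: P.divides_trans)
  qed
qed

lemma Q_not_dvd_residue:
  assumes "A \<in> residues" "A \<noteq> []"
  shows "\<not> Q pdivides A"
proof
  assume "Q pdivides A"
  from pdivides_imp_degree_le[OF carrier_is_subring Q_carrier _ assms(2) this] assms length_Q
  show False by (cases A) auto
qed

lemma poly_cong_iff_pmod:
  assumes "A \<in> carrier P" "B \<in> carrier P"
  shows "poly_cong F Q A B \<longleftrightarrow> pmod A Q = pmod B Q"
  using same_pmod_iff_pdivides[OF carrier_is_subfield assms Q_carrier] by (simp add: poly_cong_def)

lemma pmod_in_residues:
  assumes "A \<in> carrier P"
  shows "pmod A Q \<in> residues" "A \<in> residues \<Longrightarrow> pmod A Q = A"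
proof -
  show "pmod A Q \<in> residues"
    using pmod_degree[OF carrier_is_subfield assms Q_carrier Q_nonzero]
      long_division_closed[OF carrier_is_subfield assms Q_carrier] by auto
  show "pmod A Q = A" if "A \<in> residues"
  proof -
    have "degree Q > degree A"
      using that degree_Q_pos by auto
    from pmod_const[OF carrier_is_subfield assms Q_carrier this] show ?thesis by simp
  qed
qed

text \<open>
  This rigidity is what removes the off-diagonal terms from the second moment.
\<close>

lemma poly_cong_residues:
  assumes "A \<in> residues" "B \<in> residues"
  shows "poly_cong F Q A B \<longleftrightarrow> A = B"
  using assms poly_cong_iff_pmod pmod_in_residues(2) by auto

lemma poly_cong_pmod: "A \<in> carrier P \<Longrightarrow> poly_cong F Q A (pmod A Q)"
  using poly_cong_iff_pmod pmod_in_residues by auto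

lemma finite_residues: "finite residues" and card_residues: "card residues = q ^ degree Q"
  using card_polys_length_le[of "degree Q"] by auto

abbreviation K :: "'a list set ring" where "K \<equiv> P Quot (PIdl\<^bsub>P\<^esub> Q)"
abbreviation coset :: "'a list \<Rightarrow> 'a list set" where "coset A \<equiv> (PIdl\<^bsub>P\<^esub> Q) +>\<^bsub>P\<^esub> A"

sublocale K: field K
  using rupture_is_field_iff_pirreducible[OF carrier_is_subfield Q_carrier] Q_irreducible
  by (simp add: rupture_def)

lemma coset_ring_hom: "coset \<in> ring_hom P K"
  using rupture_surj_hom(1)[OF carrier_is_subring Q_carrier] by (simp add: rupture_def)

lemma coset_hom: "ring_hom_ring P K coset"
  using rupture_surj_hom(2)[OF carrier_is_subring Q_carrier] by (simp add: rupture_def)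

lemma coset_eq_iff:
  assumes "A \<in> carrier P" "B \<in> carrier P"
  shows "coset A = coset B \<longleftrightarrow> poly_cong F Q A B"
proof -
  have "coset A = coset B \<longleftrightarrow> A \<ominus>\<^bsub>P\<^esub> B \<in> PIdl\<^bsub>P\<^esub> Q"
    using P.quotient_eq_iff_same_a_r_cos[OF P.cgenideal_ideal[OF Q_carrier] assms] by simp
  also have "\<dots> \<longleftrightarrow> Q pdivides (A \<ominus>\<^bsub>P\<^esub> B)"
    using Q_carrier by (auto simp: cgenideal_def pdivides_def factor_def P.m_comm)
  finally show ?thesis by (simp add: poly_cong_def)
qed

lemma bij_betw_coset: "bij_betw coset residues (carrier K)"
  unfolding bij_betw_def
proof
  show "inj_on coset residues"
    using coset_eq_iff poly_cong_residues by (auto intro!: inj_onI)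
  have "carrier K = coset ` carrier P"
    by (auto simp: FactRing_def A_RCOSETS_def')
  also have "\<dots> = coset ` residues"
  proof (intro equalityI image_subsetI)
    fix A assume A: "A \<in> carrier P"
    then have "coset A = coset (pmod A Q)"
      using coset_eq_iff poly_cong_pmod pmod_in_residues by auto
    then show "coset A \<in> coset ` residues" using pmod_in_residues[OF A] by blast
  qed auto
  finally show "coset ` residues = carrier K" by simp
qed

lemma phi_eq: "poly_phi F Q = q ^ degree Q - 1"
proof -
  have "finite (carrier K)" "card (carrier K) = q ^ degree Q"
    using bij_betw_finite[OF bij_betw_coset] bij_betw_same_card[OF bij_betw_coset] finite_residues card_residues
    by auto
  then show ?thesis
    by (simp add: poly_phi_def K.field_Units card_Diff_singleton)
qed

lemma finite_quotient: "finite (carrier K)"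
  using bij_betw_finite[OF bij_betw_coset] finite_residues by simp

lemma phi_eq_card: "poly_phi F Q = card (carrier (Multiplicative_Group.mult_of K))"
  by (simp add: poly_phi_def K.field_Units)

lemma coset_pow: "A \<in> carrier P \<Longrightarrow> coset (A [^]\<^bsub>P\<^esub> (i::nat)) = coset A [^]\<^bsub>K\<^esub> i"
  by (rule ring_hom_ring.hom_nat_pow[OF coset_hom])

lemma coset_mult: "A \<in> carrier P \<Longrightarrow> B \<in> carrier P \<Longrightarrow> coset (A \<otimes>\<^bsub>P\<^esub> B) = coset A \<otimes>\<^bsub>K\<^esub> coset B"
  by (rule ring_hom_mult[OF coset_ring_hom])

lemma coset_closed: "A \<in> carrier P \<Longrightarrow> coset A \<in> carrier K"
  by (rule ring_hom_closed[OF coset_ring_hom])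

lemma coset_eq_zero_iff: "A \<in> carrier P \<Longrightarrow> coset A = \<zero>\<^bsub>K\<^esub> \<longleftrightarrow> Q pdivides A"
  using coset_eq_iff[of A "\<zero>\<^bsub>P\<^esub>"] ring_hom_zero[OF coset_ring_hom P.ring_axioms K.ring_axioms]
  by (simp add: poly_cong_def P.minus_eq)

text \<open>
  A representative of a generator of the cyclic group of units modulo \<open>Q\<close>. The last clause says
  that its order is exactly \<open>phi Q\<close>, in the form in which it is used: a function of the exponent
  modulo \<open>phi Q\<close> is a function of the residue class.
\<close>

definition primitive_root :: "'a list \<Rightarrow> bool" where
  "primitive_root G \<longleftrightarrow> G \<in> carrier P \<and> \<not> Q pdivides G \<and>
     (\<forall>A \<in> carrier P. \<not> Q pdivides A \<longrightarrow> (\<exists>i::nat. coset A = coset (G [^]\<^bsub>P\<^esub> i))) \<and>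
     (\<forall>i j :: nat. coset (G [^]\<^bsub>P\<^esub> i) = coset (G [^]\<^bsub>P\<^esub> j) \<longleftrightarrow>
        i mod poly_phi F Q = j mod poly_phi F Q)"

text \<open>
  The quotient by \<open>Q\<close> is a finite field, so its multiplicative group is cyclic.
\<close>

lemma ex_primitive_root: "\<exists>G. primitive_root G"
proof -
  interpret M: group "Multiplicative_Group.mult_of K"
    by (rule K.field_mult_group)
  have fin: "finite (carrier (Multiplicative_Group.mult_of K))"
    using finite_quotient by simp
  obtain g where g: "g \<in> carrier (Multiplicative_Group.mult_of K)"
      "carrier (Multiplicative_Group.mult_of K) = {g [^]\<^bsub>K\<^esub> i | i::nat. i \<in> UNIV}"
    using K.finite_field_mult_group_has_gen[OF finite_quotient] by blast
  have "g \<in> coset ` residues"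
    using g(1) unfolding bij_betw_imp_surj_on[OF bij_betw_coset] by simp
  then obtain G where G: "G \<in> carrier P" "coset G = g"
    by blast
  have "generate (Multiplicative_Group.mult_of K) {g} = carrier (Multiplicative_Group.mult_of K)"
    using M.generate_pow_on_finite_carrier[OF fin g(1)] g(2) by (simp add: Multiplicative_Group.nat_pow_mult_of)
  then have ord: "M.ord g = poly_phi F Q"
    using M.generate_pow_card[OF g(1)] phi_eq_card by simp
  have "coset (G [^]\<^bsub>P\<^esub> i) = coset (G [^]\<^bsub>P\<^esub> j) \<longleftrightarrow> i mod poly_phi F Q = j mod poly_phi F Q" for i j :: nat
  proof -
    have "coset (G [^]\<^bsub>P\<^esub> i) = coset (G [^]\<^bsub>P\<^esub> j) \<longleftrightarrow>
        g [^]\<^bsub>Multiplicative_Group.mult_of K\<^esub> int i = g [^]\<^bsub>Multiplicative_Group.mult_of K\<^esub> int j"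
      using G by (simp add: coset_pow Multiplicative_Group.nat_pow_mult_of int_pow_int)
    also have "\<dots> \<longleftrightarrow> int (poly_phi F Q) dvd int j - int i"
      using M.int_pow_eq[OF g(1)] ord by simp
    also have "\<dots> \<longleftrightarrow> int j mod int (poly_phi F Q) = int i mod int (poly_phi F Q)"
      by (simp add: mod_eq_dvd_iff)
    also have "\<dots> \<longleftrightarrow> i mod poly_phi F Q = j mod poly_phi F Q"
      by (metis of_nat_eq_iff of_nat_mod)
    finally show ?thesis .
  qed
  moreover have "\<exists>i::nat. coset A = coset (G [^]\<^bsub>P\<^esub> i)" if "A \<in> carrier P" "\<not> Q pdivides A" for A
  proof -
    have "coset A \<in> carrier (Multiplicative_Group.mult_of K)"
      using that coset_closed coset_eq_zero_iff by simp
    then show ?thesis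
      using g(2) G by (auto simp: coset_pow)
  qed
  moreover have "\<not> Q pdivides G"
    using g(1) G coset_eq_zero_iff by auto
  ultimately show ?thesis
    using G(1) unfolding primitive_root_def by blast
qed

lemma primitive_rootD:
  assumes "primitive_root G"
  shows "G \<in> carrier P" "\<not> Q pdivides G" "G [^]\<^bsub>P\<^esub> (i::nat) \<in> carrier P"
    and "A \<in> carrier P \<Longrightarrow> \<not> Q pdivides A \<Longrightarrow> \<exists>i::nat. coset A = coset (G [^]\<^bsub>P\<^esub> i)"
    and "coset (G [^]\<^bsub>P\<^esub> i) = coset (G [^]\<^bsub>P\<^esub> (j::nat)) \<longleftrightarrow> i mod poly_phi F Q = j mod poly_phi F Q"
  using assms by (simp_all only: primitive_root_def P.nat_pow_closed simp_thms)

lemma phi_pos: "poly_phi F Q > 0"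
  using K.one_not_zero finite_quotient unfolding phi_eq_card by (intro card_gt_0_iff[THEN iffD2]) auto

end

section \<open>Dirichlet characters of prime modulus\<close>

text \<open>
  Multiplication by the primitive root of unity \<open>w = cis (2 * pi / N)\<close> permutes the roots of unity
  and multiplies the sum by \<open>w ^ i * cnj (w ^ j)\<close>. This factor is \<open>1\<close> only if \<open>i\<close> and \<open>j\<close> agree
  modulo \<open>N\<close>; otherwise the sum has to vanish.
\<close>

lemma sum_roots_unity_power_cnj:
  fixes N i j :: nat
  assumes "N > 0"
  shows "(\<Sum>z | z ^ N = (1::complex). z ^ i * cnj (z ^ j)) = (if i mod N = j mod N then of_nat N else 0)"
proof -
  let ?U = "{z::complex. z ^ N = 1}"
  have red: "z ^ k = z ^ (k mod N)" if "z \<in> ?U" for z :: complex and k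
  proof -
    have "z ^ k = z ^ (N * (k div N) + k mod N)" by simp
    also have "\<dots> = z ^ (k mod N)"
      using that unfolding power_add power_mult by simp
    finally show ?thesis .
  qed
  have unit: "z ^ k * cnj (z ^ k) = 1" if "z \<in> ?U" for z :: complex and k
  proof -
    have "cmod z = 1"
      using that assms power_eq_1_iff[of z N] by simp
    then show ?thesis
      using complex_norm_square[of "z ^ k"] by (simp add: norm_power)
  qed
  show ?thesis
  proof (cases "i mod N = j mod N")
    case True
    have "z ^ i * cnj (z ^ j) = 1" if "z \<in> ?U" for z
      using unit[OF that, of i] red[OF that, of i] red[OF that, of j] True by simp
    then have "(\<Sum>z\<in>?U. z ^ i * cnj (z ^ j)) = (\<Sum>z\<in>?U. 1)"
      by (intro sum.cong) auto
    with True show ?thesis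
      by (simp add: Complex.card_roots_unity_eq[OF assms])
  next
    case False
    define w where "w = cis (2 * pi / N)"
    have w: "w \<in> ?U"
      using assms by (simp add: w_def Complex.DeMoivre)
    have w_neq: "w ^ i * cnj (w ^ j) \<noteq> 1"
    proof
      assume "w ^ i * cnj (w ^ j) = 1"
      then have "w ^ i * (w ^ j * cnj (w ^ j)) = w ^ j"
        by (metis mult.left_commute mult.right_neutral)
      then have "w ^ i = w ^ j"
        unfolding unit[OF w, of j] by simp
      then have "w ^ (i mod N) = w ^ (j mod N)"
        using red[OF w, of i] red[OF w, of j] by simp
      then have "cis (2 * pi * real (i mod N) / real N) = cis (2 * pi * real (j mod N) / real N)"
        by (simp add: w_def Complex.DeMoivre mult_ac)
      with bij_betw_imp_inj_on[OF Complex.bij_betw_roots_unity[OF assms]] have "i mod N = j mod N"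
        by (rule inj_onD) (use assms in auto)
      with False show False by simp
    qed
    have "w \<noteq> 0"
      by (simp add: w_def)
    then have "bij_betw ((*) w) ?U ?U"
      using w by (intro bij_betwI[where g = "\<lambda>z. z / w"]) (auto simp: power_mult_distrib power_divide)
    then have "(\<Sum>z\<in>?U. z ^ i * cnj (z ^ j)) = (\<Sum>z\<in>?U. (w * z) ^ i * cnj ((w * z) ^ j))"
      by (rule sum.reindex_bij_betw[symmetric])
    also have "\<dots> = w ^ i * cnj (w ^ j) * (\<Sum>z\<in>?U. z ^ i * cnj (z ^ j))"
      by (simp add: sum_distrib_left power_mult_distrib mult_ac)
    finally show ?thesis
      using w_neq False by simp
  qed
qed

context prime_modulus
begin

abbreviation characters :: "('a list \<Rightarrow> complex) set" where
  "characters \<equiv> dirichlet_characters F Q"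

text \<open>
  The conditions on a character are restated with cosets, so that congruences become equations in
  the quotient field.
\<close>

lemma charactersI:
  assumes "chi \<in> extensional (carrier P)"
    and "\<And>A B. A \<in> carrier P \<Longrightarrow> B \<in> carrier P \<Longrightarrow> coset A = coset B \<Longrightarrow> chi A = chi B"
    and "\<And>A B. A \<in> carrier P \<Longrightarrow> B \<in> carrier P \<Longrightarrow> chi (A \<otimes>\<^bsub>P\<^esub> B) = chi A * chi B"
    and "\<And>A. A \<in> carrier P \<Longrightarrow> chi A = 0 \<longleftrightarrow> Q pdivides A"
  shows "chi \<in> characters"
  unfolding dirichlet_characters_def
proof (intro CollectI conjI ballI impI)
  show "chi A = chi B" if "A \<in> carrier P" "B \<in> carrier P" "poly_cong F Q A B" for A B
    using that coset_eq_iff by (intro assms(2)) auto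
  show "chi A = 0 \<longleftrightarrow> \<not> poly_coprime F A Q" if "A \<in> carrier P" for A
    using that assms(4) poly_coprime_iff by simp
qed (use assms(1,3) in auto)

lemma charactersD:
  assumes "chi \<in> characters"
  shows "chi \<in> extensional (carrier P)"
    and "A \<in> carrier P \<Longrightarrow> B \<in> carrier P \<Longrightarrow> coset A = coset B \<Longrightarrow> chi A = chi B"
    and "A \<in> carrier P \<Longrightarrow> B \<in> carrier P \<Longrightarrow> chi (A \<otimes>\<^bsub>P\<^esub> B) = chi A * chi B"
    and "A \<in> carrier P \<Longrightarrow> chi A = 0 \<longleftrightarrow> Q pdivides A"
proof -
  show "chi \<in> extensional (carrier P)"
    and "A \<in> carrier P \<Longrightarrow> B \<in> carrier P \<Longrightarrow> chi (A \<otimes>\<^bsub>P\<^esub> B) = chi A * chi B"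
    using assms by (simp_all add: dirichlet_characters_def)
  show "chi A = chi B" if "A \<in> carrier P" "B \<in> carrier P" "coset A = coset B"
    using that assms coset_eq_iff unfolding dirichlet_characters_def by blast
  show "chi A = 0 \<longleftrightarrow> Q pdivides A" if "A \<in> carrier P"
    using that assms poly_coprime_iff unfolding dirichlet_characters_def by blast
qed

lemma not_Q_dvd_one: "\<not> Q pdivides \<one>\<^bsub>P\<^esub>"
  using coset_eq_zero_iff[of "\<one>\<^bsub>P\<^esub>"] ring_hom_one[OF coset_ring_hom] K.one_not_zero by simp

lemma character_one:
  assumes "chi \<in> characters"
  shows "chi \<one>\<^bsub>P\<^esub> = 1"
  using charactersD(3)[OF assms P.one_closed P.one_closed] charactersD(4)[OF assms P.one_closed] not_Q_dvd_one
  by simp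

lemma character_pow:
  assumes "chi \<in> characters" "A \<in> carrier P"
  shows "chi (A [^]\<^bsub>P\<^esub> (i::nat)) = chi A ^ i"
  by (induction i) (simp_all add: assms character_one charactersD(3)[OF assms(1)])

lemma trivial_character_eq:
  "trivial_character F Q = restrict (\<lambda>A. if Q pdivides A then 0 else 1) (carrier P)"
  by (auto simp: trivial_character_def poly_coprime_iff restrict_def)

lemma trivial_character_in_characters: "trivial_character F Q \<in> characters"
  unfolding trivial_character_eq
proof (rule charactersI)
  fix A B assume "A \<in> carrier P" "B \<in> carrier P" "coset A = coset B"
  then show "restrict (\<lambda>A. if Q pdivides A then 0 else 1) (carrier P) A =
      (restrict (\<lambda>A. if Q pdivides A then 0 else 1) (carrier P) B :: complex)"
    using coset_eq_zero_iff[of A] coset_eq_zero_iff[of B] by simp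
qed (auto simp: Q_dvd_mult_iff)

text \<open>
  A character is determined by its value at a primitive root, since every polynomial coprime to \<open>Q\<close>
  is congruent to a power of it, and this value is a root of unity because the power with exponent
  \<open>phi Q\<close> is congruent to \<open>1\<close>. Conversely, for every root of unity \<open>z\<close> of that order, \<open>z ^ i\<close>
  depends only on the class of the \<open>i\<close>-th power of the primitive root, and so defines a character.
\<close>

lemma bij_betw_characters:
  assumes "primitive_root G"
  shows "bij_betw (\<lambda>chi. chi G) characters {z. z ^ poly_phi F Q = 1}"
  unfolding bij_betw_def
proof
  note G = primitive_rootD(1-3)[OF assms] and G_gen = primitive_rootD(4)[OF assms]
    and G_eq = primitive_rootD(5)[OF assms]
  show "inj_on (\<lambda>chi. chi G) characters"
  proof (rule inj_onI)
    fix chi psi assume chi: "chi \<in> characters" and psi: "psi \<in> characters" and eq: "chi G = psi G"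
    show "chi = psi"
    proof (rule extensionalityI[OF charactersD(1)[OF chi] charactersD(1)[OF psi]])
      fix A assume A: "A \<in> carrier P"
      show "chi A = psi A"
      proof (cases "Q pdivides A")
        case False
        then obtain i :: nat where i: "coset A = coset (G [^]\<^bsub>P\<^esub> i)"
          using G_gen[OF A] by blast
        show ?thesis
          unfolding charactersD(2)[OF chi A G(3) i] charactersD(2)[OF psi A G(3) i]
          using eq G chi psi by (simp add: character_pow)
      qed (use charactersD(4)[OF chi A] charactersD(4)[OF psi A] in simp)
    qed
  qed
  let ?N = "poly_phi F Q"
  show "(\<lambda>chi. chi G) ` characters = {z. z ^ ?N = 1}"
  proof (intro equalityI image_subsetI subsetI)
    fix chi assume chi: "chi \<in> characters"
    have "coset (G [^]\<^bsub>P\<^esub> ?N) = coset (G [^]\<^bsub>P\<^esub> (0::nat))"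
      unfolding G_eq by simp
    from charactersD(2)[OF chi G(3) G(3) this] show "chi G \<in> {z. z ^ ?N = 1}"
      using chi G character_one by (simp add: character_pow)
  next
    fix z :: complex assume "z \<in> {z. z ^ ?N = 1}"
    then have z: "z ^ ?N = 1" by simp
    have z_nz: "z \<noteq> 0"
      using z phi_pos by (auto simp: power_0_left)
    have red: "z ^ i = z ^ j" if "coset (G [^]\<^bsub>P\<^esub> i) = coset (G [^]\<^bsub>P\<^esub> j)" for i j :: nat
    proof -
      have mod: "z ^ k = z ^ (k mod ?N)" for k
      proof -
        have "z ^ k = z ^ (?N * (k div ?N) + k mod ?N)" by simp
        also have "\<dots> = z ^ (k mod ?N)" by (simp only: power_add power_mult z power_one mult_1)
        finally show ?thesis .
      qed
      have "i mod ?N = j mod ?N"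
        using that unfolding G_eq .
      then show ?thesis
        using mod[of i] mod[of j] by simp
    qed
    \<comment> \<open>A discrete logarithm. Any choice of exponent serves: by \<open>red\<close> it does not affect the power of \<open>z\<close>.\<close>
    define ind where "ind A = (SOME i::nat. coset A = coset (G [^]\<^bsub>P\<^esub> i))" for A
    have ind: "coset A = coset (G [^]\<^bsub>P\<^esub> ind A)" if "A \<in> carrier P" "\<not> Q pdivides A" for A
      unfolding ind_def by (rule someI_ex[OF G_gen[OF that]])
    define chi where "chi = restrict (\<lambda>A. if Q pdivides A then 0 else z ^ ind A) (carrier P)"
    have dvd: "coset A = coset B \<Longrightarrow> Q pdivides A \<longleftrightarrow> Q pdivides B" if "A \<in> carrier P" "B \<in> carrier P" for A B
      using coset_eq_zero_iff[OF that(1)] coset_eq_zero_iff[OF that(2)] by simp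
    have "chi \<in> characters"
    proof (rule charactersI)
      show "chi A = chi B" if "A \<in> carrier P" "B \<in> carrier P" "coset A = coset B" for A B
      proof (cases "Q pdivides A")
        case False
        then have "coset (G [^]\<^bsub>P\<^esub> ind A) = coset (G [^]\<^bsub>P\<^esub> ind B)"
          using that ind dvd by metis
        from red[OF this] show ?thesis
          using that dvd[OF that] by (simp add: chi_def)
      qed (use that dvd[OF that] in \<open>simp add: chi_def\<close>)
      show "chi (A \<otimes>\<^bsub>P\<^esub> B) = chi A * chi B" if AB: "A \<in> carrier P" "B \<in> carrier P" for A B
      proof (cases "Q pdivides A \<or> Q pdivides B")
        case False
        then have "coset (G [^]\<^bsub>P\<^esub> ind (A \<otimes>\<^bsub>P\<^esub> B)) = coset A \<otimes>\<^bsub>K\<^esub> coset B"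
          using AB ind[of "A \<otimes>\<^bsub>P\<^esub> B"] by (simp add: Q_dvd_mult_iff coset_mult)
        also have "\<dots> = coset (G [^]\<^bsub>P\<^esub> (ind A + ind B))"
          using False AB ind[of A] ind[of B] G
          by (simp add: P.nat_pow_mult[symmetric] coset_mult)
        finally have "z ^ ind (A \<otimes>\<^bsub>P\<^esub> B) = z ^ (ind A + ind B)"
          by (rule red)
        then show ?thesis
          using AB False by (simp add: chi_def Q_dvd_mult_iff power_add)
      qed (use AB in \<open>auto simp: chi_def Q_dvd_mult_iff\<close>)
    qed (auto simp: chi_def z_nz)
    moreover have "chi G = z"
    proof -
      have "coset (G [^]\<^bsub>P\<^esub> ind G) = coset (G [^]\<^bsub>P\<^esub> (1::nat))"
        using ind[of G] G by simp
      then show ?thesis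
        using red[of "ind G" 1] G by (simp add: chi_def)
    qed
    ultimately show "z \<in> (\<lambda>chi. chi G) ` characters"
      by blast
  qed
qed

lemma finite_characters: "finite characters"
proof -
  obtain G where "primitive_root G" using ex_primitive_root by blast
  from bij_betw_finite[OF bij_betw_characters[OF this]] show ?thesis
    using finite_roots_unity[of "poly_phi F Q"] phi_pos by simp
qed

text \<open>
  In terms of the values at a primitive root, the sum over the characters is a sum over roots of
  unity, and \<open>A\<close> and \<open>B\<close> enter through their discrete logarithms only.
\<close>

lemma character_orthogonality:
  assumes "A \<in> carrier P" "B \<in> carrier P" "\<not> Q pdivides A" "\<not> Q pdivides B"
  shows "(\<Sum>chi\<in>characters. chi A * cnj (chi B)) =
           (if poly_cong F Q A B then of_nat (poly_phi F Q) else 0)"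
proof -
  obtain G where "primitive_root G" using ex_primitive_root by blast
  note G = primitive_rootD[OF this]
  obtain i j :: nat where ij: "coset A = coset (G [^]\<^bsub>P\<^esub> i)" "coset B = coset (G [^]\<^bsub>P\<^esub> j)"
    using G(4)[OF assms(1,3)] G(4)[OF assms(2,4)] by blast
  have val: "chi A = chi G ^ i" "chi B = chi G ^ j" if "chi \<in> characters" for chi
    unfolding charactersD(2)[OF that assms(1) G(3) ij(1)] charactersD(2)[OF that assms(2) G(3) ij(2)]
    using G(1) that by (simp_all add: character_pow)
  have "(\<Sum>chi\<in>characters. chi A * cnj (chi B)) = (\<Sum>chi\<in>characters. chi G ^ i * cnj (chi G ^ j))"
    using val by (intro sum.cong) auto
  also have "\<dots> = (\<Sum>z | z ^ poly_phi F Q = 1. z ^ i * cnj (z ^ j))"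
    using sum.reindex_bij_betw[OF bij_betw_characters[OF \<open>primitive_root G\<close>],
        of "\<lambda>z. z ^ i * cnj (z ^ j)"] by simp
  also have "\<dots> = (if i mod poly_phi F Q = j mod poly_phi F Q then of_nat (poly_phi F Q) else 0)"
    by (rule sum_roots_unity_power_cnj[OF phi_pos])
  also have "i mod poly_phi F Q = j mod poly_phi F Q \<longleftrightarrow> poly_cong F Q A B"
    using coset_eq_iff[OF assms(1,2)] unfolding ij G(5) by simp
  finally show ?thesis .
qed

text \<open>
  The value at a primitive root is a root of unity, hence so is every nonzero value.
\<close>

lemma character_norm_le:
  assumes "chi \<in> characters" "A \<in> carrier P"
  shows "cmod (chi A) \<le> 1"
proof (cases "Q pdivides A")
  case False
  obtain G where "primitive_root G" using ex_primitive_root by blast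
  note G = primitive_rootD[OF this]
  have "chi G ^ poly_phi F Q = 1"
    using bij_betwE[OF bij_betw_characters[OF \<open>primitive_root G\<close>]] assms(1) by auto
  then have "cmod (chi G) = 1"
    using phi_pos power_eq_1_iff[of "chi G" "poly_phi F Q"] by simp
  moreover obtain i :: nat where i: "coset A = coset (G [^]\<^bsub>P\<^esub> i)"
    using G(4)[OF assms(2) False] by blast
  from charactersD(2)[OF assms G(3) i] have "chi A = chi G ^ i"
    using assms(1) G(1) by (simp add: character_pow)
  ultimately show ?thesis
    by (simp add: norm_power)
qed (use charactersD(4)[OF assms] in simp)

text \<open>
  A map that separates residue classes permutes them, as there are finitely many, and \<open>chi\<close> sees
  only the class of its argument. The maps of interest are multiplication by a polynomial coprime
  to \<open>Q\<close>, and translations.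
\<close>

lemma sum_character_permuted_residues:
  assumes "chi \<in> characters"
    and "\<And>R. R \<in> residues \<Longrightarrow> h R \<in> carrier P"
    and "\<And>R S. R \<in> residues \<Longrightarrow> S \<in> residues \<Longrightarrow> poly_cong F Q (h R) (h S) \<Longrightarrow> R = S"
  shows "(\<Sum>R\<in>residues. chi (h R)) = (\<Sum>R\<in>residues. chi R)"
proof -
  let ?f = "\<lambda>R. pmod (h R) Q"
  have inj: "inj_on ?f residues"
  proof (rule inj_onI)
    fix R S assume RS: "R \<in> residues" "S \<in> residues" and "pmod (h R) Q = pmod (h S) Q"
    then have "poly_cong F Q (h R) (h S)"
      using poly_cong_iff_pmod[OF assms(2)[OF RS(1)] assms(2)[OF RS(2)]] by blast
    with assms(3)[OF RS] show "R = S" .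
  qed
  have "?f ` residues \<subseteq> residues"
    using pmod_in_residues(1) assms(2) by blast
  then have bij: "bij_betw ?f residues residues"
    using endo_inj_surj[OF finite_residues _ inj] inj by (auto simp: bij_betw_def)
  have "chi (h R) = chi (pmod (h R) Q)" if "R \<in> residues" for R
  proof (rule charactersD(2)[OF assms(1) assms(2)[OF that]])
    show "pmod (h R) Q \<in> carrier P"
      using pmod_in_residues(1)[OF assms(2)[OF that]] by simp
    then show "coset (h R) = coset (pmod (h R) Q)"
      using poly_cong_pmod[OF assms(2)[OF that]] coset_eq_iff[OF assms(2)[OF that]] by blast
  qed
  then have "(\<Sum>R\<in>residues. chi (h R)) = (\<Sum>R\<in>residues. chi (pmod (h R) Q))"
    by (intro sum.cong) auto
  also have "\<dots> = (\<Sum>R\<in>residues. chi R)"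
    using sum.reindex_bij_betw[OF bij, of chi] .
  finally show ?thesis .
qed

text \<open>
  Choose \<open>B\<close> coprime to \<open>Q\<close> with \<open>chi B \<noteq> 1\<close>. Multiplication by \<open>B\<close> permutes the residue classes,
  so it leaves the sum unchanged; it also multiplies the sum by \<open>chi B\<close>.
\<close>

lemma sum_character_residues:
  assumes "chi \<in> characters" "chi \<noteq> trivial_character F Q"
  shows "(\<Sum>R\<in>residues. chi R) = 0"
proof -
  have "\<exists>B\<in>carrier P. chi B \<noteq> trivial_character F Q B"
  proof (rule ccontr)
    assume "\<not> ?thesis"
    then have "chi = trivial_character F Q"
      by (intro extensionalityI[OF charactersD(1)[OF assms(1)]
          charactersD(1)[OF trivial_character_in_characters]]) blast
    with assms(2) show False by contradiction
  qed
  then obtain B where B: "B \<in> carrier P" "chi B \<noteq> trivial_character F Q B"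
    by blast
  then have nd: "\<not> Q pdivides B" and neq: "chi B \<noteq> 1"
    using charactersD(4)[OF assms(1), of B] by (auto simp: trivial_character_eq split: if_splits)
  have "chi B * (\<Sum>R\<in>residues. chi R) = (\<Sum>R\<in>residues. chi (B \<otimes>\<^bsub>P\<^esub> R))"
    using charactersD(3)[OF assms(1) B(1)] by (auto simp: sum_distrib_left intro!: sum.cong)
  also have "\<dots> = (\<Sum>R\<in>residues. chi R)"
  proof (rule sum_character_permuted_residues[OF assms(1)])
    show "R = S" if RS: "R \<in> residues" "S \<in> residues" "poly_cong F Q (B \<otimes>\<^bsub>P\<^esub> R) (B \<otimes>\<^bsub>P\<^esub> S)" for R S
    proof -
      have "(B \<otimes>\<^bsub>P\<^esub> R) \<ominus>\<^bsub>P\<^esub> (B \<otimes>\<^bsub>P\<^esub> S) = B \<otimes>\<^bsub>P\<^esub> (R \<ominus>\<^bsub>P\<^esub> S)"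
        using B(1) RS(1,2) by (simp add: P.minus_eq P.r_distr P.r_minus)
      then have "Q pdivides (B \<otimes>\<^bsub>P\<^esub> (R \<ominus>\<^bsub>P\<^esub> S))"
        using RS(3) by (simp add: poly_cong_def)
      then have "poly_cong F Q R S"
        using RS(1,2) B(1) nd Q_dvd_mult_iff[of B "R \<ominus>\<^bsub>P\<^esub> S"] by (simp add: poly_cong_def)
      then show ?thesis using poly_cong_residues RS by blast
    qed
  qed (use B(1) in auto)
  finally show ?thesis using neq by simp
qed

text \<open>
  Translation by a residue permutes the monic polynomials of degree \<open>m\<close>, as \<open>m \<ge> degree Q\<close>. The
  average of the translated sums over all residues is therefore the original sum; on the other hand,
  for each fixed \<open>A\<close> the translates of \<open>A\<close> run through a complete system of residues, over which
  \<open>chi\<close> sums to zero.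
\<close>

lemma sum_character_monic_degree:
  assumes "chi \<in> characters" "chi \<noteq> trivial_character F Q" "m \<ge> degree Q"
  shows "(\<Sum>A | A \<in> monic_polys F \<and> degree A = m. chi A) = 0"
proof -
  let ?M = "{A \<in> monic_polys F. degree A = m}"
  have M_carrier: "A \<in> carrier P" if "A \<in> ?M" for A
    using that by (simp add: monic_polys_def)
  have shift: "(\<Sum>A\<in>?M. chi (A \<oplus>\<^bsub>P\<^esub> R)) = (\<Sum>A\<in>?M. chi A)" if R: "R \<in> residues" for R
  proof -
    have inj: "inj_on (\<lambda>A. A \<oplus>\<^bsub>P\<^esub> R) ?M"
    proof (rule inj_onI)
      fix A B assume AB: "A \<in> ?M" "B \<in> ?M" and eq: "A \<oplus>\<^bsub>P\<^esub> R = B \<oplus>\<^bsub>P\<^esub> R"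
      have "R \<in> carrier P"
        using R by simp
      from P.add.right_cancel[OF this M_carrier[OF AB(1)] M_carrier[OF AB(2)]] eq show "A = B"
        by (rule iffD1)
    qed
    have "A \<oplus>\<^bsub>P\<^esub> R \<in> ?M" if "A \<in> ?M" for A
    proof -
      have "A \<in> monic_polys F" "degree A = m" "R \<in> carrier P" "length R \<le> degree A"
        using that R assms(3) by simp_all
      from monic_add_lower_degree[OF this(1,3,4)] this(2) show ?thesis
        by (simp only: mem_Collect_eq simp_thms)
    qed
    then have sub: "(\<lambda>A. A \<oplus>\<^bsub>P\<^esub> R) ` ?M \<subseteq> ?M"
      by (rule image_subsetI)
    have "bij_betw (\<lambda>A. A \<oplus>\<^bsub>P\<^esub> R) ?M ?M"
      unfolding bij_betw_def by (rule conjI[OF inj endo_inj_surj[OF card_monic_polys_degree(1) sub inj]])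
    from sum.reindex_bij_betw[OF this, of chi] show ?thesis .
  qed
  have zero: "(\<Sum>R\<in>residues. chi (A \<oplus>\<^bsub>P\<^esub> R)) = 0" if A: "A \<in> ?M" for A
  proof -
    have "(\<Sum>R\<in>residues. chi (A \<oplus>\<^bsub>P\<^esub> R)) = (\<Sum>R\<in>residues. chi R)"
    proof (rule sum_character_permuted_residues[OF assms(1)])
      show "R = S" if RS: "R \<in> residues" "S \<in> residues" "poly_cong F Q (A \<oplus>\<^bsub>P\<^esub> R) (A \<oplus>\<^bsub>P\<^esub> S)" for R S
      proof -
        have carr: "A \<in> carrier P" "R \<in> carrier P" "S \<in> carrier P"
          using RS(1,2) M_carrier[OF A] by simp_all
        then have "coset A \<oplus>\<^bsub>K\<^esub> coset R = coset A \<oplus>\<^bsub>K\<^esub> coset S"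
          using RS(3) coset_eq_iff[of "A \<oplus>\<^bsub>P\<^esub> R" "A \<oplus>\<^bsub>P\<^esub> S"]
          by (simp add: ring_hom_add[OF coset_ring_hom])
        then have "coset R = coset S"
          using K.add.l_cancel[OF _ coset_closed coset_closed coset_closed] carr by blast
        then have "poly_cong F Q R S"
          using coset_eq_iff carr by blast
        then show ?thesis using poly_cong_residues RS by blast
      qed
    qed (use M_carrier[OF A] in auto)
    then show ?thesis
      using sum_character_residues[OF assms(1,2)] by simp
  qed
  have "of_nat (card residues) * (\<Sum>A\<in>?M. chi A) = (\<Sum>R\<in>residues. \<Sum>A\<in>?M. chi (A \<oplus>\<^bsub>P\<^esub> R))"
    by (simp only: sum.cong[OF refl shift] sum_constant)
  also have "\<dots> = (\<Sum>A\<in>?M. \<Sum>R\<in>residues. chi (A \<oplus>\<^bsub>P\<^esub> R))"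
    by (rule sum.swap)
  also have "\<dots> = 0"
    by (intro sum.neutral ballI zero)
  finally have "card residues = 0 \<or> (\<Sum>A\<in>?M. chi A) = 0"
    by (simp only: mult_eq_0_iff of_nat_eq_0_iff)
  moreover have "card residues \<noteq> 0"
    unfolding card_residues using finite_carrier zero_closed by (auto simp: card_eq_0_iff)
  ultimately show ?thesis
    by blast
qed

end

section \<open>The L-function as a Dirichlet polynomial\<close>

lemma higher_deriv_exponential_sum:
  fixes a c :: "'b \<Rightarrow> complex"
  assumes "\<And>x. x \<in> S \<Longrightarrow> a x \<noteq> 0"
  shows "(deriv ^^ k) (\<lambda>s. \<Sum>x\<in>S. c x * a x powr (- s)) =
           (\<lambda>s. \<Sum>x\<in>S. c x * ((- Ln (a x)) ^ k * a x powr (- s)))"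
proof (induction k)
  case (Suc k)
  have "deriv (\<lambda>s. \<Sum>x\<in>S. c x * ((- Ln (a x)) ^ k * a x powr (- s))) s =
      (\<Sum>x\<in>S. c x * ((- Ln (a x)) ^ Suc k * a x powr (- s)))" for s
  proof (rule DERIV_imp_deriv, rule DERIV_sum)
    fix x assume "x \<in> S"
    then have "((\<lambda>s. a x powr (- s)) has_field_derivative Ln (a x) * a x powr (- s) * (- 1)) (at s)"
      by (intro DERIV_chain2[OF has_field_derivative_powr_right[OF assms]]) (auto intro!: derivative_eq_intros)
    then have "((\<lambda>s. c x * ((- Ln (a x)) ^ k * a x powr (- s))) has_field_derivative
        c x * ((- Ln (a x)) ^ k * (Ln (a x) * a x powr (- s) * (- 1)))) (at s)"
      by (intro DERIV_cmult)
    then show "((\<lambda>s. c x * ((- Ln (a x)) ^ k * a x powr (- s))) has_field_derivative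
        c x * ((- Ln (a x)) ^ Suc k * a x powr (- s))) (at s)"
      by (simp add: mult_ac)
  qed
  then show ?case
    unfolding funpow.simps comp_apply Suc.IH by (rule ext)
qed simp

context finite_field
begin

text \<open>
  The \<open>q ^ m\<close> monic polynomials of degree \<open>m\<close> all have norm \<open>q ^ m\<close>, so this is a geometric
  series with ratio \<open>q powr (1 - s)\<close>.
\<close>

lemma summable_poly_norm:
  assumes "s > 1"
  shows "(\<lambda>A. real (poly_norm F A) powr (- s)) summable_on monic_polys F"
proof -
  have q: "real q > 1"
    using q_ge_2 by simp
  have "(\<lambda>x. real (poly_norm F (snd x)) powr (- s)) summable_on Sigma UNIV monics"
  proof (rule summable_on_SigmaI)
    fix m
    have "(\<Sum>A\<in>monics m. real (poly_norm F A) powr (- s)) = (real q powr (1 - s)) ^ m"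
    proof -
      have "(\<Sum>A\<in>monics m. real (poly_norm F A) powr (- s)) = (\<Sum>A\<in>monics m. (real q ^ m) powr (- s))"
        by (intro sum.cong) (auto simp: poly_norm_def)
      also have "\<dots> = real q ^ m * (real q ^ m) powr (- s)"
        by (simp only: sum_constant card_monic_polys_degree(2) of_nat_power)
      also have "\<dots> = (real q powr (1 - s)) ^ m"
        using q by (simp add: powr_realpow[symmetric] powr_powr powr_add[symmetric] algebra_simps)
      finally show ?thesis .
    qed
    then show "((\<lambda>A. real (poly_norm F (snd (m, A))) powr (- s)) has_sum (real q powr (1 - s)) ^ m) (monics m)"
      using has_sum_finite[OF card_monic_polys_degree(1)] by (metis (no_types, lifting) snd_conv has_sum_cong)
  next
    have "real q powr (1 - s) < 1"
      using q assms by (simp add: powr_less_one)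
    then show "(\<lambda>m. (real q powr (1 - s)) ^ m) summable_on UNIV"
      by (subst summable_on_UNIV_nonneg_real_iff) (auto intro!: summable_geometric)
  qed simp
  then show ?thesis
    using summable_on_reindex_bij_betw[OF bij_betw_monics, of "\<lambda>A. real (poly_norm F A) powr (- s)"] by simp
qed

end

context prime_modulus
begin

abbreviation low_monics :: "'a list set" where
  "low_monics \<equiv> {A \<in> monic_polys F. degree A < degree Q}"

text \<open>
  Absolute convergence allows summation degree by degree, and all degrees from \<open>degree Q\<close> on
  contribute zero.
\<close>

lemma L_series_eq:
  assumes chi: "chi \<in> characters" "chi \<noteq> trivial_character F Q" and s: "Re s > 1"
  shows "L_series F chi s = (\<Sum>A\<in>low_monics. chi A * of_nat (poly_norm F A) powr (- s))"
proof -
  let ?f = "\<lambda>A. chi A * of_nat (poly_norm F A) powr (- s)"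
  have norm_f: "cmod (?f A) \<le> real (poly_norm F A) powr (- Re s)" if "A \<in> monic_polys F" for A
  proof -
    have "A \<in> carrier P"
      using that by (simp add: monic_polys_def)
    moreover have "poly_norm F A > 0"
      using q_ge_2 by (simp add: poly_norm_def)
    then have "cmod (of_nat (poly_norm F A) powr (- s)) = real (poly_norm F A) powr (- Re s)"
      using norm_powr_real_powr[of "of_nat (poly_norm F A)" "- s"] by simp
    ultimately show ?thesis
      using character_norm_le[OF chi(1)] by (simp add: norm_mult mult_left_le_one_le)
  qed
  have "?f summable_on monic_polys F"
    by (rule abs_summable_summable, rule Infinite_Sum.abs_summable_on_comparison_test'[OF summable_poly_norm[OF s] norm_f])
  then have summ: "(\<lambda>(m, A). ?f A) summable_on Sigma UNIV monics"
    using summable_on_reindex_bij_betw[OF bij_betw_monics, of ?f] by (simp add: case_prod_unfold)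
  have zero: "(\<Sum>A\<in>monics m. ?f A) = 0" if "m \<ge> degree Q" for m
  proof -
    have "(\<Sum>A\<in>monics m. ?f A) = (\<Sum>A\<in>monics m. chi A) * of_nat (q ^ m) powr (- s)"
      unfolding sum_distrib_right by (intro sum.cong) (auto simp: poly_norm_def)
    then show ?thesis
      using sum_character_monic_degree[OF chi that] by simp
  qed
  have "L_series F chi s = (\<Sum>\<^sub>\<infinity>(m, A)\<in>Sigma UNIV monics. ?f A)"
    unfolding L_series_def using infsum_reindex_bij_betw[OF bij_betw_monics, of ?f]
    by (simp add: case_prod_unfold)
  also have "\<dots> = (\<Sum>\<^sub>\<infinity>m. \<Sum>\<^sub>\<infinity>A\<in>monics m. ?f A)"
    by (rule infsum_Sigma'_banach[OF summ, symmetric])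
  also have "\<dots> = (\<Sum>\<^sub>\<infinity>m. \<Sum>A\<in>monics m. ?f A)"
    by (simp only: infsum_finite[OF card_monic_polys_degree(1)])
  also have "\<dots> = (\<Sum>\<^sub>\<infinity>m\<in>{..<degree Q}. \<Sum>A\<in>monics m. ?f A)"
    using zero by (intro infsum_cong_neutral) auto
  also have "\<dots> = (\<Sum>A\<in>low_monics. ?f A)"
    by (simp only: infsum_finite finite_lessThan sum_monic_degree_less)
  finally show ?thesis .
qed

text \<open>
  A finite sum of exponentials in \<open>s\<close> is entire, so it is the analytic continuation of the series
  with which it agrees for \<open>Re s > 1\<close>.
\<close>

lemma L_function_eq:
  assumes chi: "chi \<in> characters" "chi \<noteq> trivial_character F Q"
  shows "L_function F chi = (\<lambda>s. \<Sum>A\<in>low_monics. chi A * of_nat (poly_norm F A) powr (- s))"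
proof (rule L_function_eqI)
  show "(\<lambda>s. \<Sum>A\<in>low_monics. chi A * of_nat (poly_norm F A) powr (- s)) holomorphic_on UNIV"
    using q_ge_2 by (auto intro!: holomorphic_intros simp: poly_norm_def)
qed (use L_series_eq[OF chi] in simp)

text \<open>
  This is \<open>(- ln \<bar>A\<bar>) ^ k / sqrt \<bar>A\<bar>\<close>, the coefficient of \<open>chi A\<close> in the \<open>k\<close>-th derivative of the
  L-function at \<open>1 / 2\<close>; it is written in terms of the degree, by which the sums are grouped.
\<close>

definition central_weight :: "nat \<Rightarrow> 'a list \<Rightarrow> real" where
  "central_weight k A = (- ln (real q)) ^ k * real (degree A) ^ k / sqrt (real q) ^ degree A"

lemma higher_deriv_L_function_half:
  assumes chi: "chi \<in> characters" "chi \<noteq> trivial_character F Q"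
  shows "(deriv ^^ k) (L_function F chi) (1 / 2) = (\<Sum>A\<in>low_monics. chi A * of_real (central_weight k A))"
proof -
  have nz: "of_nat (poly_norm F A) \<noteq> (0::complex)" for A
    using q_ge_2 by (simp add: poly_norm_def)
  have "(- Ln (of_nat (poly_norm F A))) ^ k * of_nat (poly_norm F A) powr (- (1 / 2)) =
      complex_of_real (central_weight k A)" for A
  proof -
    let ?m = "degree A"
    have "real (poly_norm F A) powr (- (1 / 2)) = inverse (sqrt (real q ^ ?m))"
      using q_ge_2 by (simp add: poly_norm_def powr_minus powr_half_sqrt)
    then have "(of_nat (poly_norm F A) :: complex) powr (- (1 / 2)) = of_real (1 / sqrt (real q) ^ ?m)"
      using powr_of_real[of "real (poly_norm F A)" "- (1 / 2)"] by (simp add: real_sqrt_power field_simps)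
    moreover have "Ln (of_nat (poly_norm F A)) = of_real (real ?m * ln (real q))"
    proof -
      have "poly_norm F A > 0"
        using q_ge_2 by (simp add: poly_norm_def)
      then have "Ln (of_nat (poly_norm F A)) = of_real (ln (real (poly_norm F A)))"
        by (rule Ln_of_nat)
      also have "ln (real (poly_norm F A)) = real ?m * ln (real q)"
        using q_ge_2 unfolding poly_norm_def of_nat_power by (intro ln_realpow)
      finally show ?thesis .
    qed
    ultimately show ?thesis
      by (simp add: central_weight_def power_mult_distrib power_minus[of "_ * _"] power_minus[of "complex_of_real _"] mult_ac)
  qed
  then show ?thesis
    unfolding L_function_eq[OF chi] higher_deriv_exponential_sum[OF nz] by simp
qed

end

section \<open>The second moment\<close>

text \<open>
  The increment \<open>(n + 1) ^ (j + 1) - n ^ (j + 1)\<close> factors as a sum of \<open>j + 1\<close> products of powers of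
  \<open>n\<close> and \<open>n + 1\<close> of total degree \<open>j\<close>, each of which lies between \<open>n ^ j\<close> and \<open>(n + 1) ^ j\<close>. Both
  bounds follow by adding up these increments.
\<close>

lemma sum_powers_bounds:
  fixes n j :: nat
  shows "(\<Sum>m<n. real m ^ j) \<le> real n ^ (j + 1) / real (j + 1)"
    and "real n ^ (j + 1) / real (j + 1) - real n ^ j \<le> (\<Sum>m<n. real m ^ j)"
proof -
  have step: "real (j + 1) * real n ^ j \<le> real (Suc n) ^ (j + 1) - real n ^ (j + 1)"
    "real (Suc n) ^ (j + 1) - real n ^ (j + 1) \<le> real (j + 1) * real (Suc n) ^ j" for n
  proof -
    have eq: "real (Suc n) ^ (j + 1) - real n ^ (j + 1) = (\<Sum>i<Suc j. real n ^ (j - i) * real (Suc n) ^ i)"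
      using power_diff_sumr2[of "real (Suc n)" "Suc j" "real n"] by simp
    have "real n ^ j \<le> real n ^ (j - i) * real (Suc n) ^ i"
      and "real n ^ (j - i) * real (Suc n) ^ i \<le> real (Suc n) ^ j" if "i \<in> {..<Suc j}" for i
    proof -
      have j: "x ^ (j - i) * x ^ i = x ^ j" for x :: real
        using that by (simp add: power_add[symmetric])
      have "real n ^ (j - i) * real n ^ i \<le> real n ^ (j - i) * real (Suc n) ^ i"
        by (intro mult_left_mono power_mono) auto
      then show "real n ^ j \<le> real n ^ (j - i) * real (Suc n) ^ i"
        unfolding j .
      have "real n ^ (j - i) * real (Suc n) ^ i \<le> real (Suc n) ^ (j - i) * real (Suc n) ^ i"
        by (intro mult_right_mono power_mono) auto
      then show "real n ^ (j - i) * real (Suc n) ^ i \<le> real (Suc n) ^ j"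
        unfolding j .
    qed
    from sum_bounded_below[of "{..<Suc j}" "real n ^ j" "\<lambda>i. real n ^ (j - i) * real (Suc n) ^ i", OF this(1)]
      sum_bounded_above[of "{..<Suc j}" "\<lambda>i. real n ^ (j - i) * real (Suc n) ^ i" "real (Suc n) ^ j", OF this(2)]
    show "real (j + 1) * real n ^ j \<le> real (Suc n) ^ (j + 1) - real n ^ (j + 1)"
      "real (Suc n) ^ (j + 1) - real n ^ (j + 1) \<le> real (j + 1) * real (Suc n) ^ j"
      unfolding eq by simp_all
  qed
  show "(\<Sum>m<n. real m ^ j) \<le> real n ^ (j + 1) / real (j + 1)"
  proof (induction n)
    case (Suc n)
    have "real n ^ j \<le> (real (Suc n) ^ (j + 1) - real n ^ (j + 1)) / real (j + 1)"
      using step(1)[of n] by (simp add: pos_le_divide_eq mult.commute)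
    then show ?case
      using Suc by (simp add: diff_divide_distrib)
  qed simp
  show "real n ^ (j + 1) / real (j + 1) - real n ^ j \<le> (\<Sum>m<n. real m ^ j)"
  proof (induction n)
    case (Suc n)
    have "(real (Suc n) ^ (j + 1) - real n ^ (j + 1)) / real (j + 1) \<le> real (Suc n) ^ j"
      using step(2)[of n] by (simp add: pos_divide_le_eq mult.commute)
    then show ?case
      using Suc by (simp add: diff_divide_distrib)
  qed simp
qed

text \<open>
  With \<open>r = sqrt q\<close> this bounds the contribution of the trivial character: there \<open>r\<^sup>2 ^ n - 1\<close> is
  \<open>phi Q\<close>. Replacing \<open>m ^ k\<close> by \<open>n ^ k\<close> leaves a geometric sum, whose denominator \<open>r - 1\<close> is bounded
  away from zero uniformly in \<open>r\<close>, because \<open>r\<close> is at least the square root of \<open>2\<close> and so at least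
  \<open>7 / 5\<close>.
\<close>

lemma square_weighted_geometric_sum_le:
  fixes r :: real and n k :: nat
  assumes "r\<^sup>2 \<ge> 2" "r \<ge> 0"
  shows "(\<Sum>m<n. real m ^ k * r ^ m)\<^sup>2 \<le> 25 / 4 * real n ^ (2 * k) * ((r\<^sup>2) ^ n - 1)"
proof -
  have "(7 / 5)\<^sup>2 \<le> r\<^sup>2"
    using assms(1) by (simp add: power2_eq_square)
  then have r: "r \<ge> 7 / 5"
    by (rule power2_le_imp_le[OF _ assms(2)])
  have rn: "r ^ n \<ge> 1"
    using r by simp
  have "(\<Sum>m<n. real m ^ k * r ^ m) \<le> (\<Sum>m<n. real n ^ k * r ^ m)"
    using assms by (intro sum_mono mult_right_mono power_mono) auto
  also have "\<dots> = real n ^ k * ((r ^ n - 1) / (r - 1))"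
    using r by (simp add: sum_distrib_left[symmetric] geometric_sum)
  also have "(r ^ n - 1) / (r - 1) \<le> (r ^ n - 1) / (2 / 5)"
    using r rn by (intro divide_left_mono) auto
  finally have "(\<Sum>m<n. real m ^ k * r ^ m) \<le> real n ^ k * ((r ^ n - 1) / (2 / 5))"
    by (simp add: mult_left_mono)
  then have "(\<Sum>m<n. real m ^ k * r ^ m)\<^sup>2 \<le> (real n ^ k * ((r ^ n - 1) / (2 / 5)))\<^sup>2"
    using assms by (intro power_mono sum_nonneg) auto
  also have "\<dots> = 25 / 4 * real n ^ (2 * k) * (r ^ n - 1)\<^sup>2"
  proof -
    have "(a * (b / (2 / 5)))\<^sup>2 = 25 / 4 * a\<^sup>2 * b\<^sup>2" for a b :: real
      by (simp add: power2_eq_square)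
    moreover have "real n ^ (2 * k) = (real n ^ k)\<^sup>2"
      by (simp add: power_mult[symmetric] mult.commute)
    ultimately show ?thesis
      by (simp only:)
  qed
  also have "\<dots> \<le> 25 / 4 * real n ^ (2 * k) * ((r\<^sup>2) ^ n - 1)"
  proof (rule mult_left_mono)
    have "(r\<^sup>2) ^ n = (r ^ n)\<^sup>2"
      by (simp add: power_mult[symmetric] mult.commute)
    then show "(r ^ n - 1)\<^sup>2 \<le> (r\<^sup>2) ^ n - 1"
      using rn by (simp add: power2_eq_square algebra_simps)
  qed simp
  finally show ?thesis .
qed

context prime_modulus
begin

text \<open>
  Distinct nonzero residues are coprime to \<open>Q\<close> and incongruent, so orthogonality annihilates every
  off-diagonal term, and the identity is exact.
\<close>

lemma second_moment_characters:
  fixes c :: "'a list \<Rightarrow> complex"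
  assumes "S \<subseteq> residues - {[]}"
  shows "(\<Sum>chi\<in>characters. (cmod (\<Sum>A\<in>S. chi A * c A))\<^sup>2) =
           real (poly_phi F Q) * (\<Sum>A\<in>S. (cmod (c A))\<^sup>2)"
proof -
  have fin: "finite S"
    using assms finite_residues by (meson finite_Diff finite_subset)
  have orth: "(\<Sum>chi\<in>characters. chi A * cnj (chi B)) = (if A = B then of_nat (poly_phi F Q) else 0)"
    if "A \<in> S" "B \<in> S" for A B
  proof -
    have AB: "A \<in> residues" "B \<in> residues" "A \<noteq> []" "B \<noteq> []"
      using that assms by auto
    then show ?thesis
      using character_orthogonality[of A B] Q_not_dvd_residue poly_cong_residues[of A B] by simp
  qed
  have "complex_of_real (\<Sum>chi\<in>characters. (cmod (\<Sum>A\<in>S. chi A * c A))\<^sup>2) =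
      (\<Sum>chi\<in>characters. \<Sum>A\<in>S. \<Sum>B\<in>S. c A * cnj (c B) * (chi A * cnj (chi B)))"
    unfolding of_real_sum complex_norm_square cnj_sum sum_product complex_cnj_mult by (simp only: mult_ac)
  also have "\<dots> = (\<Sum>A\<in>S. \<Sum>B\<in>S. c A * cnj (c B) * (\<Sum>chi\<in>characters. chi A * cnj (chi B)))"
    unfolding sum_distrib_left
    by (subst sum.swap, rule sum.cong[OF refl], rule sum.swap)
  also have "\<dots> = (\<Sum>A\<in>S. \<Sum>B\<in>S. if A = B then c A * cnj (c B) * of_nat (poly_phi F Q) else 0)"
    by (intro sum.cong refl) (simp add: orth)
  also have "\<dots> = (\<Sum>A\<in>S. c A * cnj (c A) * of_nat (poly_phi F Q))"
    using fin by simp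
  also have "\<dots> = complex_of_real (real (poly_phi F Q) * (\<Sum>A\<in>S. (cmod (c A))\<^sup>2))"
    by (simp only: of_real_mult of_real_sum complex_norm_square sum_distrib_left of_real_of_nat_eq mult_ac)
  finally show ?thesis
    by (simp only: of_real_eq_iff)
qed

lemma low_monics_residues: "low_monics \<subseteq> residues - {[]}"
  by (auto simp: monic_polys_def)

lemma real_phi: "real (poly_phi F Q) = real q ^ degree Q - 1"
  using q_ge_2 by (simp add: phi_eq of_nat_diff)

lemma sum_central_weight_squares:
  "(\<Sum>A\<in>low_monics. (central_weight k A)\<^sup>2) = ln (real q) ^ (2 * k) * (\<Sum>m<degree Q. real m ^ (2 * k))"
proof -
  have "(\<Sum>A\<in>monics m. (central_weight k A)\<^sup>2) = ln (real q) ^ (2 * k) * real m ^ (2 * k)" for m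
  proof -
    have "(\<Sum>A\<in>monics m. (central_weight k A)\<^sup>2) =
        (\<Sum>A\<in>monics m. ln (real q) ^ (2 * k) * real m ^ (2 * k) / real q ^ m)"
    proof (rule sum.cong)
      fix A assume A: "A \<in> monics m"
      have "(sqrt (real q) ^ m)\<^sup>2 = real q ^ m"
        by (simp add: power_mult[symmetric] mult.commute[of m 2]) (simp add: power_mult)
      then show "(central_weight k A)\<^sup>2 = ln (real q) ^ (2 * k) * real m ^ (2 * k) / real q ^ m"
        using A by (simp add: central_weight_def power_divide power_mult_distrib power_mult[symmetric] mult.commute[of k 2])
    qed simp
    then show ?thesis
      using q_ge_2 by (simp only: sum_constant card_monic_polys_degree(2)) simp
  qed
  then show ?thesis
    by (simp only: sum_monic_degree_less sum_distrib_left)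
qed

lemma trivial_character_sum:
  "(\<Sum>A\<in>low_monics. trivial_character F Q A * of_real (central_weight k A)) =
     of_real ((- ln (real q)) ^ k * (\<Sum>m<degree Q. real m ^ k * sqrt (real q) ^ m))"
proof -
  have "trivial_character F Q A = 1" if "A \<in> low_monics" for A
    using that low_monics_residues Q_not_dvd_residue[of A] by (auto simp: trivial_character_eq)
  then have "(\<Sum>A\<in>low_monics. trivial_character F Q A * of_real (central_weight k A)) =
      of_real (\<Sum>A\<in>low_monics. central_weight k A)"
    by simp
  also have "(\<Sum>A\<in>monics m. central_weight k A) = (- ln (real q)) ^ k * (real m ^ k * sqrt (real q) ^ m)" for m
  proof -
    have q: "real q ^ m = sqrt (real q) ^ m * sqrt (real q) ^ m"
      by (simp add: power_mult_distrib[symmetric])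
    have "(\<Sum>A\<in>monics m. central_weight k A) =
        (\<Sum>A\<in>monics m. (- ln (real q)) ^ k * real m ^ k / sqrt (real q) ^ m)"
      by (intro sum.cong) (auto simp: central_weight_def)
    then show ?thesis
      using q_ge_2 by (simp only: sum_constant card_monic_polys_degree(2)) (simp add: q)
  qed
  then have "(\<Sum>A\<in>low_monics. central_weight k A) =
      (- ln (real q)) ^ k * (\<Sum>m<degree Q. real m ^ k * sqrt (real q) ^ m)"
    by (simp only: sum_monic_degree_less sum_distrib_left)
  finally show ?thesis .
qed

text \<open>
  For a nontrivial character the derivative at \<open>1 / 2\<close> is the Dirichlet polynomial with the
  coefficients \<open>central_weight k\<close>. The second moment of this polynomial over all characters is known
  from orthogonality; the subtracted square comes from its value at the trivial character, for which
  it does not represent the derivative of the L-function.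
\<close>

lemma second_moment_L_function:
  "(\<Sum>chi\<in>characters - {trivial_character F Q}. (cmod ((deriv ^^ k) (L_function F chi) (1 / 2)))\<^sup>2) =
     ln (real q) ^ (2 * k) * (real (poly_phi F Q) * (\<Sum>m<degree Q. real m ^ (2 * k)) -
       (\<Sum>m<degree Q. real m ^ k * sqrt (real q) ^ m)\<^sup>2)"
proof -
  let ?D = "\<lambda>chi. \<Sum>A\<in>low_monics. chi A * complex_of_real (central_weight k A)"
  let ?T = "\<Sum>m<degree Q. real m ^ k * sqrt (real q) ^ m"
  have "(\<Sum>chi\<in>characters - {trivial_character F Q}. (cmod ((deriv ^^ k) (L_function F chi) (1 / 2)))\<^sup>2) =
      (\<Sum>chi\<in>characters - {trivial_character F Q}. (cmod (?D chi))\<^sup>2)"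
    by (intro sum.cong refl) (simp add: higher_deriv_L_function_half)
  also have "\<dots> = (\<Sum>chi\<in>characters. (cmod (?D chi))\<^sup>2) - (cmod (?D (trivial_character F Q)))\<^sup>2"
    by (simp add: sum_diff1 finite_characters trivial_character_in_characters)
  also have "(\<Sum>chi\<in>characters. (cmod (?D chi))\<^sup>2) =
      real (poly_phi F Q) * (ln (real q) ^ (2 * k) * (\<Sum>m<degree Q. real m ^ (2 * k)))"
    by (simp only: second_moment_characters[OF low_monics_residues] norm_of_real power2_abs
        sum_central_weight_squares)
  also have "(cmod (?D (trivial_character F Q)))\<^sup>2 = ln (real q) ^ (2 * k) * ?T\<^sup>2"
    unfolding trivial_character_sum norm_of_real
    by (simp add: power_mult_distrib power_mult[symmetric] mult.commute[of k 2])
  finally show ?thesis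
    by (simp add: algebra_simps)
qed

lemma second_moment_asymptotic:
  "\<bar>1 / real (poly_phi F Q) *
       (\<Sum>chi\<in>characters - {trivial_character F Q}. (cmod ((deriv ^^ k) (L_function F chi) (1 / 2)))\<^sup>2)
     - ln (real q) ^ (2 * k) / real (2 * k + 1) * real (degree Q) ^ (2 * k + 1)\<bar>
   \<le> 8 * (ln (real q) ^ (2 * k) * real (degree Q) ^ (2 * k))"
proof -
  define n where "n = degree Q"
  define S where "S = (\<Sum>m<n. real m ^ (2 * k))"
  define T where "T = (\<Sum>m<n. real m ^ k * sqrt (real q) ^ m)"
  define l where "l = ln (real q) ^ (2 * k)"
  define U where "U = real n ^ (2 * k + 1) / real (2 * k + 1)"
  define V where "V = real n ^ (2 * k)"
  have phi: "real (poly_phi F Q) = real q ^ n - 1" "real q ^ n - 1 > 0"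
    using real_phi phi_pos by (simp_all add: n_def)
  have "S \<le> U" "U - V \<le> S"
    using sum_powers_bounds[where n = n and j = "2 * k"] by (simp_all add: S_def U_def V_def)
  moreover have "T\<^sup>2 / (real q ^ n - 1) \<le> 25 / 4 * V"
    using square_weighted_geometric_sum_le[where r = "sqrt (real q)" and n = n and k = k] q_ge_2 phi(2)
    by (simp add: T_def V_def pos_divide_le_eq)
  moreover have "T\<^sup>2 / (real q ^ n - 1) \<ge> 0" "V \<ge> 0"
    using phi(2) by (simp_all add: V_def)
  \<comment> \<open>The constant: \<open>1\<close> from the power sum and \<open>25 / 4\<close> from the trivial character, rounded up.\<close>
  ultimately have "\<bar>S - T\<^sup>2 / (real q ^ n - 1) - U\<bar> \<le> 8 * V"
    by linarith
  then have "l * \<bar>S - T\<^sup>2 / (real q ^ n - 1) - U\<bar> \<le> l * (8 * V)"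
    by (rule mult_left_mono) (simp add: l_def)
  moreover have "l * \<bar>S - T\<^sup>2 / (real q ^ n - 1) - U\<bar> = \<bar>l * (S - T\<^sup>2 / (real q ^ n - 1) - U)\<bar>"
    by (simp add: abs_mult l_def)
  moreover have "l * (S - T\<^sup>2 / (real q ^ n - 1) - U) =
      1 / (real q ^ n - 1) * (l * ((real q ^ n - 1) * S - T\<^sup>2)) - l / real (2 * k + 1) * real n ^ (2 * k + 1)"
    using phi(2) by (simp add: U_def field_simps)
  ultimately have "\<bar>1 / (real q ^ n - 1) * (l * ((real q ^ n - 1) * S - T\<^sup>2)) -
      l / real (2 * k + 1) * real n ^ (2 * k + 1)\<bar> \<le> 8 * (l * V)"
    by (simp only: mult.left_commute)
  then show ?thesis
    unfolding second_moment_L_function phi(1) by (simp only: l_def S_def T_def V_def n_def)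
qed

end

theorem theorem2p5:
  shows "\<exists>C::real. \<forall>F :: 'a ring. field F \<and> finite (carrier F) \<longrightarrow>
    (\<forall>k::nat. k \<ge> 1 \<longrightarrow>
      (\<exists>N::nat. \<forall>Q \<in> monic_primes F. Polynomials.degree Q \<ge> N \<longrightarrow>
        \<bar>1 / real (poly_phi F Q) *
           (\<Sum>chi \<in> dirichlet_characters F Q - {trivial_character F Q}.
              (cmod ((deriv ^^ k) (L_function F chi) (1 / 2)))\<^sup>2)
         - ln (real (card (carrier F))) ^ (2 * k) / real (2 * k + 1)
             * real (Polynomials.degree Q) ^ (2 * k + 1)\<bar>
        \<le> C * (ln (real (card (carrier F))) ^ (2 * k) * real (Polynomials.degree Q) ^ (2 * k))))"
proof (intro exI[of _ 8] allI impI exI[of _ 0] ballI)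
  fix F :: "'a ring" and k :: nat and Q
  assume "field F \<and> finite (carrier F)" "Q \<in> monic_primes F"
  then interpret prime_modulus F Q
    by (simp add: prime_modulus_def finite_field_def finite_field_axioms_def prime_modulus_axioms_def)
  show "\<bar>1 / real (poly_phi F Q) *
           (\<Sum>chi \<in> dirichlet_characters F Q - {trivial_character F Q}.
              (cmod ((deriv ^^ k) (L_function F chi) (1 / 2)))\<^sup>2)
         - ln (real (card (carrier F))) ^ (2 * k) / real (2 * k + 1)
             * real (Polynomials.degree Q) ^ (2 * k + 1)\<bar>
        \<le> 8 * (ln (real (card (carrier F))) ^ (2 * k) * real (Polynomials.degree Q) ^ (2 * k))"
    by (rule second_moment_asymptotic)
qed

end
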